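(* Let $\mathfrak{g}$ be a finite-dimensional Leibniz algebra such that $[\mathfrak{g},\mathfrak{g}]=\gamma_2^{\mathsf{Lie}}(\mathfrak{g})$ and $Z_{\mathsf{Lie}}(\mathfrak{g})\subseteq Z^r(\mathfrak{g})$. Then $\mathsf{ID}_*^{\mathsf{Lie}}(\mathfrak{g})=\mathsf{Der}_z^{\mathsf{Lie}}(\mathfrak{g})$ if and only if $\gamma_2^{\mathsf{Lie}}(\mathfrak{g})=Z_{\mathsf{Lie}}(\mathfrak{g})$.
   Context: $\mathbb{K}$ is a fixed ground field with $\frac12\in\mathbb{K}$. A Leibniz algebra over $\mathbb{K}$ is a $\mathbb{K}$-vector space $\mathfrak{g}$ with a bilinear bracket satisfying $[x,[y,z]]=[[x,y],z]-[[x,z],y]$ for all $x,y,z$. Put $[x,y]_{lie}=[x,y]+[y,x]$. $[\mathfrak{g},\mathfrak{g}]$ is the span of all brackets $[x,y]$. The $\mathsf{Lie}$-center is $Z_{\mathsf{Lie}}(\mathfrak{g})=\{z\in\mathfrak{g}\mid [g,z]_{lie}=0\ \text{for all } g\in\mathfrak{g}\}$, and the right-center is $Z^r(\mathfrak{g})=\{x\in\mathfrak{g}\mid[y,x]=0\ \text{for all }y\in\mathfrak{g}\}$. $\gamma_2^{\mathsf{Lie}}(\mathfrak{g})=[\mathfrak{g},\mathfrak{g}]_{\mathsf{Lie}}$ is the two-sided ideal generated by all $[x,y]_{lie}$, $x,y\in\mathfrak{g}$. A $\mathsf{Lie}$-derivation of $\mathfrak{g}$ is a linear map $d:\mathfrak{g}\to\mathfrak{g}$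 with $d([x,y]_{lie})=[d(x),y]_{lie}+[x,d(y)]_{lie}$ for all $x,y$. $\mathsf{Der}_z^{\mathsf{Lie}}(\mathfrak{g})$ is the set of $\mathsf{Lie}$-derivations $d$ with $d(\mathfrak{g})\subseteq Z_{\mathsf{Lie}}(\mathfrak{g})$. $\mathsf{ID}_*^{\mathsf{Lie}}(\mathfrak{g})$ is the set of $\mathsf{Lie}$-derivations $d$ with $d(\mathfrak{g})\subseteq\gamma_2^{\mathsf{Lie}}(\mathfrak{g})$ and $d(Z_{\mathsf{Lie}}(\mathfrak{g}))=0$. *)

theory Defs
  imports Complex_Main
begin

text \<open>Right Leibniz algebras. The underlying vector space is a whole type
  carrying a \<^locale>\<open>vector_space\<close> structure over an arbitrary field.\<close>

locale leibniz_algebra = vector_space scale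
  for scale :: "'k::field \<Rightarrow> 'g::ab_group_add \<Rightarrow> 'g" +
  fixes bracket :: "'g \<Rightarrow> 'g \<Rightarrow> 'g"
  assumes linear_bracket_left: "\<And>y. Vector_Spaces.linear scale scale (\<lambda>x. bracket x y)"
    and linear_bracket_right: "\<And>x. Vector_Spaces.linear scale scale (\<lambda>y. bracket x y)"
    and leibniz_identity:
      "\<And>x y z. bracket x (bracket y z) = bracket (bracket x y) z - bracket (bracket x z) y"
begin

definition lie_bracket :: "'g \<Rightarrow> 'g \<Rightarrow> 'g" where
  "lie_bracket x y = bracket x y + bracket y x"

definition derived_subalgebra :: "'g set" where
  "derived_subalgebra = span {bracket x y |x y. True}"

definition lie_center :: "'g set" where
  "lie_center = {z. \<forall>g. lie_bracket g z = 0}"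

definition right_center :: "'g set" where
  "right_center = {x. \<forall>y. bracket y x = 0}"

definition two_sided_ideal :: "'g set \<Rightarrow> bool" where
  "two_sided_ideal I \<longleftrightarrow> subspace I \<and> (\<forall>x. \<forall>a\<in>I. bracket x a \<in> I \<and> bracket a x \<in> I)"

definition gamma2_lie :: "'g set" where
  "gamma2_lie = two_sided_ideal hull {lie_bracket x y |x y. True}"

definition lie_derivation :: "('g \<Rightarrow> 'g) \<Rightarrow> bool" where
  "lie_derivation d \<longleftrightarrow> Vector_Spaces.linear scale scale d \<and>
     (\<forall>x y. d (lie_bracket x y) = lie_bracket (d x) y + lie_bracket x (d y))"

definition Der_z_lie :: "('g \<Rightarrow> 'g) set" where
  "Der_z_lie = {d. lie_derivation d \<and> range d \<subseteq> lie_center}"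

definition ID_star_lie :: "('g \<Rightarrow> 'g) set" where
  "ID_star_lie = {d. lie_derivation d \<and> range d \<subseteq> gamma2_lie \<and> (\<forall>z\<in>lie_center. d z = 0)}"

end

end

theory Submission
  imports Defs
begin

text \<open>
  By the Leibniz identity every \<open>[x,y]\<^sub>l\<^sub>i\<^sub>e\<close> lies in the right center, so the span of these elements
  is already a two-sided ideal, namely \<open>\<gamma>\<^sub>2\<close>. Hence the Lie-derivations with values in the Lie-center
  \<open>Z\<close> are exactly the linear maps into \<open>Z\<close> that vanish on \<open>\<gamma>\<^sub>2\<close>, which settles the case \<open>\<gamma>\<^sub>2 = Z\<close>.
  Conversely, right multiplications are derivations belonging to \<open>ID\<^sub>*\<close>, so if they take values in \<open>Z\<close>
  then \<open>\<gamma>\<^sub>2 = [g,g] \<subseteq> Z\<close>; and for \<open>z \<in> Z\<close> a rank-one map onto the line of \<open>z\<close> that vanishes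
  on \<open>\<gamma>\<^sub>2\<close> can belong to \<open>ID\<^sub>*\<close> only if \<open>z \<in> \<gamma>\<^sub>2\<close>.
\<close>

text \<open>A basis of \<open>S\<close> stays independent when \<open>x\<close> is added, so the
  values 0 on the basis and \<open>z\<close> at \<open>x\<close> can be prescribed freely.\<close>

lemma (in vector_space) exists_linear_map_separating_subspace:
  assumes "subspace S" "x \<notin> S"
  obtains d where "Vector_Spaces.linear scale scale d" "\<forall>v\<in>S. d v = 0" "d x = z"
    "range d \<subseteq> span {z}"
proof -
  interpret vector_space_pair scale scale ..
  obtain B where B: "B \<subseteq> S" "independent B" "S \<subseteq> span B"
    using maximal_independent_subset by blast
  have SB: "span B = S" using B assms(1) span_minimal by blast
  have indep: "independent (insert x B)"
    using B assms(2) SB by (simp add: independent_insertI)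
  have x: "x \<notin> B" using B assms by auto
  \<comment> \<open>This extension also fixes the range as the span of the prescribed values, which
    keeps \<open>d\<close> inside the line of \<open>z\<close>.\<close>
  obtain d where d: "Vector_Spaces.linear scale scale d"
      "\<forall>v\<in>insert x B. d v = (if v = x then z else 0)"
      "range d = span ((\<lambda>v. if v = x then z else 0) ` insert x B)"
    using linear_independent_extend_subspace[OF indep, of "\<lambda>v. if v = x then z else 0"] by blast
  have "d v = 0" if "v \<in> S" for v
  proof (rule linear_eq_0_on_span[OF d(1)])
    show "d b = 0" if "b \<in> B" for b using d(2) x that by auto
  qed (use that SB in simp)
  moreover have "range d \<subseteq> span {z}"
    unfolding d(3) by (rule span_minimal) (auto intro: span_base span_zero)
  ultimately show thesis using that d by auto
qed

context leibniz_algebra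
begin

lemma bracket_linear_simps [simp]:
  "bracket (x + y) z = bracket x z + bracket y z"
  "bracket z (x + y) = bracket z x + bracket z y"
  "bracket (scale c x) z = scale c (bracket x z)"
  "bracket z (scale c x) = scale c (bracket z x)"
  "bracket 0 z = 0"
  "bracket z 0 = 0"
proof -
  interpret vector_space_pair scale scale ..
  note left = linear_bracket_left[of z] and right = linear_bracket_right[of z]
  show "bracket (x + y) z = bracket x z + bracket y z" by (rule linear_add[OF left])
  show "bracket z (x + y) = bracket z x + bracket z y" by (rule linear_add[OF right])
  show "bracket (scale c x) z = scale c (bracket x z)" by (rule linear_scale[OF left])
  show "bracket z (scale c x) = scale c (bracket z x)" by (rule linear_scale[OF right])
  show "bracket 0 z = 0" by (rule linear_0[OF left])
  show "bracket z 0 = 0" by (rule linear_0[OF right])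
qed

text \<open>The Leibniz expansions of \<open>[x,[y,z]]\<close> and \<open>[x,[z,y]]\<close> are
  negatives of each other.\<close>

lemma bracket_lie_bracket_right: "bracket x (lie_bracket y z) = 0"
  by (simp add: lie_bracket_def leibniz_identity)

lemma two_sided_ideal_span_lie_brackets: "two_sided_ideal (span {lie_bracket x y |x y. True})"
  (is "two_sided_ideal (span ?L)")
proof -
  have "bracket x a = 0 \<and> bracket a x \<in> span ?L" if "a \<in> span ?L" for a x
    using that
  proof (induction rule: span_induct_alt)
    case base
    then show ?case by (simp add: span_zero)
  next
    case (step c b y)
    then obtain u v where b: "b = lie_bracket u v" by blast
    then have "bracket x b = 0" by (simp add: bracket_lie_bracket_right)
    \<comment> \<open>Since \<open>[x,b] = 0\<close>, the product on the other side is itself a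
      symmetrized bracket, hence a generator of the span.\<close>
    then have "bracket b x = lie_bracket b x" by (simp add: lie_bracket_def)
    then have "bracket b x \<in> span ?L" by (auto intro: span_base)
    then show ?case
      using step \<open>bracket x b = 0\<close> by (simp add: span_add span_scale)
  qed
  then show ?thesis by (auto simp: two_sided_ideal_def span_zero)
qed

lemma gamma2_lie_eq_span: "gamma2_lie = span {lie_bracket x y |x y. True}"
  unfolding gamma2_lie_def
proof (rule hull_unique)
  show "span {lie_bracket x y |x y. True} \<subseteq> I"
    if "{lie_bracket x y |x y. True} \<subseteq> I" "two_sided_ideal I" for I
    using that by (simp add: span_minimal two_sided_ideal_def)
qed (rule span_superset two_sided_ideal_span_lie_brackets)+

lemma subspace_lie_center: "subspace lie_center"
proof (rule subspaceI)
  fix x y :: 'g and c :: 'k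
  show "0 \<in> lie_center" by (simp add: lie_center_def lie_bracket_def)
  have "lie_bracket g (x + y) = lie_bracket g x + lie_bracket g y"
    and "lie_bracket g (scale c x) = scale c (lie_bracket g x)" for g
    by (simp_all add: lie_bracket_def algebra_simps)
  then show "x \<in> lie_center \<Longrightarrow> y \<in> lie_center \<Longrightarrow> x + y \<in> lie_center"
    and "x \<in> lie_center \<Longrightarrow> scale c x \<in> lie_center"
    by (auto simp: lie_center_def)
qed

text \<open>For values in the Lie-center both terms on the right of the derivation rule vanish, so
  the rule only says that \<open>d\<close> kills the generators of
  \<open>gamma2_lie\<close>.\<close>

lemma Der_z_lie_iff:
  "d \<in> Der_z_lie \<longleftrightarrow>
    Vector_Spaces.linear scale scale d \<and> range d \<subseteq> lie_center \<and> (\<forall>v\<in>gamma2_lie. d v = 0)"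
proof -
  interpret vector_space_pair scale scale ..
  have vanish: "(\<forall>x y. d (lie_bracket x y) = 0) \<longleftrightarrow> (\<forall>v\<in>gamma2_lie. d v = 0)"
    if "Vector_Spaces.linear scale scale d"
  proof
    assume *: "\<forall>x y. d (lie_bracket x y) = 0"
    show "\<forall>v\<in>gamma2_lie. d v = 0"
      unfolding gamma2_lie_eq_span
      by (intro ballI, erule linear_eq_0_on_span[OF that, rotated]) (use * in auto)
  next
    assume *: "\<forall>v\<in>gamma2_lie. d v = 0"
    have "lie_bracket x y \<in> gamma2_lie" for x y
      unfolding gamma2_lie_eq_span by (auto intro: span_base)
    with * show "\<forall>x y. d (lie_bracket x y) = 0" by blast
  qed
  have "lie_bracket x (d y) = 0" if "range d \<subseteq> lie_center" for x y
    using that by (auto simp: lie_center_def)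
  moreover have "lie_bracket (d y) x = lie_bracket x (d y)" for x y
    by (simp add: lie_bracket_def add.commute)
  ultimately show ?thesis using vanish
    by (auto simp: Der_z_lie_def lie_derivation_def)
qed

text \<open>The derivation rule is the Leibniz identity solved for \<open>[[y,w],x]\<close> and
  symmetrized in \<open>y\<close> and \<open>w\<close>. A Lie-central \<open>z\<close> satisfies
  \<open>[z,x] = -[x,z]\<close>, and \<open>[x,z] = 0\<close> because \<open>z\<close> is
  right-central.\<close>

lemma right_multiplication_in_ID_star_lie:
  assumes "derived_subalgebra = gamma2_lie" "lie_center \<subseteq> right_center"
  shows "(\<lambda>y. bracket y x) \<in> ID_star_lie"
proof -
  have "bracket z x = 0" if "z \<in> lie_center" for z
  proof -
    have "bracket x z = 0" using that assms(2) by (auto simp: right_center_def)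
    moreover have "bracket x z + bracket z x = 0"
      using that by (simp add: lie_center_def lie_bracket_def)
    ultimately show ?thesis by simp
  qed
  moreover have "bracket y x \<in> gamma2_lie" for y
    unfolding assms(1)[symmetric] derived_subalgebra_def by (auto intro: span_base)
  ultimately show ?thesis
    by (auto simp: ID_star_lie_def lie_derivation_def linear_bracket_left lie_bracket_def
        leibniz_identity)
qed

lemma derived_subalgebra_subset_lie_center:
  assumes "derived_subalgebra = gamma2_lie" "lie_center \<subseteq> right_center"
    and "ID_star_lie \<subseteq> Der_z_lie"
  shows "derived_subalgebra \<subseteq> lie_center"
  unfolding derived_subalgebra_def
proof (rule span_minimal[OF _ subspace_lie_center])
  show "{bracket x y |x y. True} \<subseteq> lie_center"
    using right_multiplication_in_ID_star_lie[OF assms(1,2)] assms(3)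
    by (fastforce simp: Der_z_lie_def)
qed

lemma lie_center_subset_gamma2_lie:
  assumes "Der_z_lie \<subseteq> ID_star_lie"
  shows "lie_center \<subseteq> gamma2_lie"
proof (rule subsetI, rule ccontr)
  fix z assume z: "z \<in> lie_center" "z \<notin> gamma2_lie"
  have "subspace gamma2_lie" by (simp add: gamma2_lie_eq_span)
  then obtain d where d: "Vector_Spaces.linear scale scale d" "\<forall>v\<in>gamma2_lie. d v = 0"
      "d z = z" "range d \<subseteq> span {z}"
    using exists_linear_map_separating_subspace z(2) by metis
  \<comment> \<open>The map \<open>d\<close> now takes Lie-central values and kills
    \<open>gamma2_lie\<close>, so it lies in \<open>Der_z_lie\<close>; by assumption its value
    \<open>d z = z\<close> must then fall in \<open>gamma2_lie\<close>.\<close>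
  have "span {z} \<subseteq> lie_center" by (simp add: z(1) span_minimal subspace_lie_center)
  with d have "d \<in> ID_star_lie" using assms by (auto simp: Der_z_lie_iff)
  then have "d z \<in> gamma2_lie" by (auto simp: ID_star_lie_def)
  with d(3) z(2) show False by simp
qed

lemma ID_star_lie_eq_Der_z_lie:
  assumes "gamma2_lie = lie_center"
  shows "ID_star_lie = Der_z_lie"
proof
  show "ID_star_lie \<subseteq> Der_z_lie"
    using assms by (auto simp: ID_star_lie_def Der_z_lie_def)
  show "Der_z_lie \<subseteq> ID_star_lie"
  proof
    fix d assume d: "d \<in> Der_z_lie"
    \<comment> \<open>Vanishing on \<open>gamma2_lie\<close> becomes vanishing on the Lie-center, as
      the two coincide.\<close>
    then have "\<forall>z\<in>lie_center. d z = 0" unfolding Der_z_lie_iff assms by blast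
    with d show "d \<in> ID_star_lie" by (simp add: Der_z_lie_def ID_star_lie_def assms)
  qed
qed

end

theorem corollary5p6:
  fixes scale :: "'k::field \<Rightarrow> 'g::ab_group_add \<Rightarrow> 'g"
    and bracket :: "'g \<Rightarrow> 'g \<Rightarrow> 'g"
  assumes "(2::'k) \<noteq> 0"
    and "leibniz_algebra scale bracket"
    and "\<exists>B. finite_dimensional_vector_space scale B"
    and "leibniz_algebra.derived_subalgebra scale bracket = leibniz_algebra.gamma2_lie scale bracket"
    and "leibniz_algebra.lie_center bracket \<subseteq> leibniz_algebra.right_center bracket"
  shows "leibniz_algebra.ID_star_lie scale bracket = leibniz_algebra.Der_z_lie scale bracket \<longleftrightarrow>
    leibniz_algebra.gamma2_lie scale bracket = leibniz_algebra.lie_center bracket"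
proof -
  interpret leibniz_algebra scale bracket by fact
  show ?thesis
    using derived_subalgebra_subset_lie_center lie_center_subset_gamma2_lie
      ID_star_lie_eq_Der_z_lie assms(4,5) by blast
qed

end
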